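(* Let $\mathfrak{L}=\bigoplus_{\alpha\in G}\mathfrak{L}_\alpha$ be a Lie algebra over a field $\mathbb{F}$ admitting a regular weakly triangular decomposition $\mathfrak{L}=\mathfrak{L}^-\oplus\mathfrak{h}\oplus\mathfrak{L}^+$ over $G=G_-\cup\{0\}\cup G_+$. Assume that $\mathfrak{L}^+=\bigoplus_{\alpha\in G_+}\mathfrak{L}_\alpha$ is completely self-centralizing and $\dim\mathfrak{h}=k$. If $\mathfrak{s}$ is a finite-dimensional Lie subalgebra of $\mathfrak{L}$, then $\dim\mathfrak{s}\le k+2$. Moreover, if $\dim\mathfrak{s}=k+2$, then $\mathfrak{s}=\mathbb{F}y\oplus\mathfrak{h}\oplus\mathbb{F}x$ for some $\alpha,\beta\in G_+$, $x\in\mathfrak{L}_\alpha$, $y\in\mathfrak{L}_{-\beta}$.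
   Context: A Lie algebra $\mathfrak{L}$ over a field $\mathbb{F}$ admits a weakly triangular decomposition if: (1) $\mathfrak{L}=\mathfrak{L}^-\oplus\mathfrak{h}\oplus\mathfrak{L}^+$ for some subalgebras $\mathfrak{L}^{\pm}$ and $\mathfrak{h}$, where $\mathfrak{h}$ is abelian; (2) $\mathfrak{L}^+\neq0$, $[\mathfrak{h},\mathfrak{L}^+]\subseteq\mathfrak{L}^+$, and $\mathfrak{L}^+$ admits a weight space decomposition relative to $\mathfrak{h}$ (under the adjoint representation) with weights $\alpha\neq0$ lying in a free additive semigroup $G_+\subseteq\mathfrak{h}^*$; (3) there is an anti-involution $\sigma$ on $\mathfrak{L}$ (a linear map with $\sigma([x,y])=[\sigma(y),\sigma(x)]$ and $\sigma^2=\mathrm{id}$) such that $\sigma(\mathfrak{L}^+)=\mathfrak{L}^-$ and $\sigma|_{\mathfrak{h}}=\mathrm{id}_{\mathfrak{h}}$; (4) there is a total ordering $>$ on $G_+$ such that for all $\alpha,\beta,\gamma\in G_+$: (a) $\alpha+\beta>\alpha$; and (b) if $\beta\ge\gamma$ then $\alpha+\beta\ge\alpha+\gamma$. For $\alpha\in\mathfrak{h}^*$ let $\mathfrak{L}_\alpha=\{x\in\mathfrak{L}\mid[h,x]=\alpha(h)x\text{ for all }h\in\mathfrak{h}\}$ (possibly $0$); then $\mathfrak{L}_0=\mathfrak{h}$. Let $G_-=\{-\alpha\mid\alpha\in G_+\}$ and $G=G_-\cup\{0\}\cup G_+$, so $\mathfrak{L}^{\pm}=\bigoplus_{\alpha\in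 G_\pm}\mathfrak{L}_\alpha$ and $\mathfrak{L}=\bigoplus_{\alpha\in G}\mathfrak{L}_\alpha$. The decomposition is regular if all the spaces $\mathfrak{L}_\alpha$ are finite-dimensional. A nonzero element $x$ of a Lie algebra $\mathfrak{K}$ over $\mathbb{F}$ is self-centralizing in $\mathfrak{K}$ if, for $y\in\mathfrak{K}$, $[x,y]=0$ implies $y\in\mathbb{F}x$. A Lie algebra $\mathfrak{K}$ with $\dim\mathfrak{K}>1$ is completely self-centralizing if every nonzero element of $\mathfrak{K}$ is self-centralizing in $\mathfrak{K}$. *)

theory Defs
  imports Main "HOL.Vector_Spaces" "HOL-Library.Multiset" "HOL-Library.Function_Algebras"
begin

locale lie_algebra = vector_space scale
  for scale :: "'f::field \<Rightarrow> 'v::ab_group_add \<Rightarrow> 'v" +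
  fixes bracket :: "'v \<Rightarrow> 'v \<Rightarrow> 'v"
  assumes bracket_add_left: "bracket (x + y) z = bracket x z + bracket y z"
    and bracket_add_right: "bracket x (y + z) = bracket x y + bracket x z"
    and bracket_scale_left: "bracket (scale c x) y = scale c (bracket x y)"
    and bracket_scale_right: "bracket x (scale c y) = scale c (bracket x y)"
    and bracket_self: "bracket x x = 0"
    and jacobi: "bracket x (bracket y z) + bracket y (bracket z x) + bracket z (bracket x y) = 0"
begin

definition subalgebra :: "'v set \<Rightarrow> bool" where
  "subalgebra K \<longleftrightarrow> subspace K \<and> (\<forall>x\<in>K. \<forall>y\<in>K. bracket x y \<in> K)"

text \<open>\<^term>\<open>dim\<close> is only meaningful together with this predicate: the library assigns
  dimension 0 to a space without a finite basis.\<close>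

definition fin_dim :: "'v set \<Rightarrow> bool" where
  "fin_dim V \<longleftrightarrow> (\<exists>B. finite B \<and> V = span B)"

definition direct_sum :: "'i set \<Rightarrow> ('i \<Rightarrow> 'v set) \<Rightarrow> 'v set \<Rightarrow> bool" where
  "direct_sum I W V \<longleftrightarrow>
     (\<forall>i\<in>I. subspace (W i)) \<and>
     V = span (\<Union>i\<in>I. W i) \<and>
     (\<forall>J f. finite J \<and> J \<subseteq> I \<and> (\<forall>i\<in>J. f i \<in> W i) \<and> (\<Sum>i\<in>J. f i) = 0
        \<longrightarrow> (\<forall>i\<in>J. f i = 0))"

definition direct_sum_list :: "'v set list \<Rightarrow> 'v set \<Rightarrow> bool" where
  "direct_sum_list Ws V \<longleftrightarrow> direct_sum {..<length Ws} (\<lambda>i. Ws ! i) V"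

text \<open>Functionals on a subspace \<open>H\<close> are normalised to vanish outside \<open>H\<close>, so that each
  element of the dual of \<open>H\<close> is represented by exactly one function; pointwise addition and
  negation preserve this normalisation.\<close>

definition dual :: "'v set \<Rightarrow> ('v \<Rightarrow> 'f) set" where
  "dual H = {f. (\<forall>x\<in>H. \<forall>y\<in>H. f (x + y) = f x + f y) \<and>
                (\<forall>c. \<forall>x\<in>H. f (scale c x) = c * f x) \<and>
                (\<forall>x. x \<notin> H \<longrightarrow> f x = 0)}"

definition weight_space :: "'v set \<Rightarrow> ('v \<Rightarrow> 'f) \<Rightarrow> 'v set" where
  "weight_space H \<alpha> = {x. \<forall>h\<in>H. bracket h x = scale (\<alpha> h) x}"

text \<open>Nonempty finite multisets over \<open>B\<close> form the free commutative semigroup on \<open>B\<close>; a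
  subsemigroup of an additive group is free with basis \<open>B\<close> iff summation identifies it with
  these multisets.\<close>

definition free_additive_semigroup :: "('v \<Rightarrow> 'f) set \<Rightarrow> bool" where
  "free_additive_semigroup S \<longleftrightarrow>
     (\<exists>B. bij_betw sum_mset {M. M \<noteq> {#} \<and> set_mset M \<subseteq> B} S)"

definition anti_involution :: "('v \<Rightarrow> 'v) \<Rightarrow> bool" where
  "anti_involution \<sigma> \<longleftrightarrow>
     Vector_Spaces.linear scale scale \<sigma> \<and>
     (\<forall>x y. \<sigma> (bracket x y) = bracket (\<sigma> y) (\<sigma> x)) \<and>
     (\<forall>x. \<sigma> (\<sigma> x) = x)"

text \<open>In the last conjunct, \<open>(\<beta>, \<alpha>) \<in> r\<close> encodes \<open>\<alpha> \<ge> \<beta>\<close>.\<close>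

definition weakly_triangular_decomposition ::
    "'v set \<Rightarrow> 'v set \<Rightarrow> 'v set \<Rightarrow> ('v \<Rightarrow> 'f) set \<Rightarrow> bool" where
  "weakly_triangular_decomposition Lminus H Lplus Gplus \<longleftrightarrow>
     (subalgebra Lminus \<and> subalgebra H \<and> subalgebra Lplus \<and>
      direct_sum_list [Lminus, H, Lplus] UNIV \<and>
      (\<forall>x\<in>H. \<forall>y\<in>H. bracket x y = 0)) \<and>
     (Lplus \<noteq> {0} \<and>
      (\<forall>h\<in>H. \<forall>x\<in>Lplus. bracket h x \<in> Lplus) \<and>
      Gplus \<subseteq> dual H \<and> free_additive_semigroup Gplus \<and>
      direct_sum (Gplus - {0}) (\<lambda>\<alpha>. Lplus \<inter> weight_space H \<alpha>) Lplus) \<and>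
     (\<exists>\<sigma>. anti_involution \<sigma> \<and> \<sigma> ` Lplus = Lminus \<and> (\<forall>h\<in>H. \<sigma> h = h)) \<and>
     (\<exists>r. linear_order_on Gplus r \<and>
        (\<forall>\<alpha>\<in>Gplus. \<forall>\<beta>\<in>Gplus. (\<alpha>, \<alpha> + \<beta>) \<in> r \<and> \<alpha> + \<beta> \<noteq> \<alpha>) \<and>
        (\<forall>\<alpha>\<in>Gplus. \<forall>\<beta>\<in>Gplus. \<forall>\<gamma>\<in>Gplus. (\<gamma>, \<beta>) \<in> r \<longrightarrow> (\<alpha> + \<gamma>, \<alpha> + \<beta>) \<in> r))"

definition regular_weakly_triangular_decomposition ::
    "'v set \<Rightarrow> 'v set \<Rightarrow> 'v set \<Rightarrow> ('v \<Rightarrow> 'f) set \<Rightarrow> bool" where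
  "regular_weakly_triangular_decomposition Lminus H Lplus Gplus \<longleftrightarrow>
     weakly_triangular_decomposition Lminus H Lplus Gplus \<and>
     (\<forall>\<alpha>\<in>dual H. fin_dim (weight_space H \<alpha>))"

definition self_centralizing_in :: "'v \<Rightarrow> 'v set \<Rightarrow> bool" where
  "self_centralizing_in x K \<longleftrightarrow>
     x \<in> K \<and> x \<noteq> 0 \<and> (\<forall>y\<in>K. bracket x y = 0 \<longrightarrow> y \<in> span {x})"

text \<open>The first conjunct after \<open>subalgebra K\<close> says that the dimension of \<open>K\<close>, finite or
  infinite, exceeds 1.\<close>

definition completely_self_centralizing :: "'v set \<Rightarrow> bool" where
  "completely_self_centralizing K \<longleftrightarrow>
     subalgebra K \<and> (fin_dim K \<longrightarrow> dim K > 1) \<and>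
     (\<forall>x\<in>K. x \<noteq> 0 \<longrightarrow> self_centralizing_in x K)"

end

end

theory Submission imports Defs begin

text \<open>Split every \<open>v\<close> into its weight components. The weights that occur are \<open>0\<close>, with weight
  space \<open>H\<close>, and those in \<open>Gplus\<close> and \<open>-Gplus\<close>; call the components for the last two positive and
  negative. A finite-dimensional subalgebra \<open>s\<close> has only finitely many weights, so there is a
  greatest positive one, \<open>\<alpha>\<close>, carried by some \<open>x \<in> s\<close>. If \<open>y \<in> s\<close> has greatest positive weight
  \<open>\<beta>\<close>, then the component of \<open>[x, y] \<in> s\<close> of weight \<open>\<alpha> + \<beta> > \<alpha>\<close> is the bracket of the two leading
  components. By maximality of \<open>\<alpha>\<close> it vanishes, and since \<open>Lplus\<close> is completely self-centralizing
  the leading component of \<open>y\<close> is a multiple of that of \<open>x\<close>; in particular \<open>\<beta> = \<alpha>\<close>. Subtracting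
  that multiple of \<open>x\<close> from \<open>y\<close> leaves an element of \<open>s\<close> whose component at \<open>\<alpha>\<close> is zero, and so, by
  what was just shown, one without any positive component (\<open>positive_part_corank_one\<close>).

  So the elements of \<open>s\<close> without positive components form a subspace of codimension at most one.
  The anti-involution \<open>\<sigma>\<close> exchanges positive and negative weights, hence the same holds for those
  without negative components. The two subspaces meet in \<open>s \<inter> H\<close>, which therefore has codimension
  at most two in \<open>s\<close> (\<open>subalgebra_subset_span\<close>). This is the dimension bound.

  Equality forces \<open>H \<subseteq> s\<close>. Then \<open>s\<close> is stable under \<open>ad H\<close>, so it contains the components of its
  elements and is the sum of \<open>s \<inter> Lminus\<close>, \<open>H\<close> and \<open>s \<inter> Lplus\<close>. The outer two summands have
  dimension at most one by the codimension statements, and, being graded, each is spanned by a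
  weight vector (\<open>subalgebra_containing_H\<close>).\<close>

section \<open>Weight vectors\<close>

context lie_algebra
begin

lemma bracket_zero_left: "bracket 0 y = 0"
  using bracket_add_left[of 0 0 y] by simp

lemma bracket_zero_right: "bracket x 0 = 0"
  using bracket_add_right[of x 0 0] by simp

lemma bracket_anticommute: "bracket x y = - bracket y x"
proof -
  have "bracket (x + y) (x + y) = bracket x x + bracket y x + (bracket x y + bracket y y)"
    by (simp only: bracket_add_left bracket_add_right)
  then have "bracket x y + bracket y x = 0"
    by (simp add: bracket_self add.commute)
  then show ?thesis
    by (simp only: eq_neg_iff_add_eq_0)
qed

lemma bracket_sum_left: "bracket (\<Sum>i\<in>J. f i) y = (\<Sum>i\<in>J. bracket (f i) y)"
  by (induction J rule: infinite_finite_induct) (simp_all add: bracket_zero_left bracket_add_left)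

lemma bracket_sum_right: "bracket x (\<Sum>i\<in>J. f i) = (\<Sum>i\<in>J. bracket x (f i))"
  by (induction J rule: infinite_finite_induct) (simp_all add: bracket_zero_right bracket_add_right)

lemma bracket_derivation: "bracket h (bracket x y) = bracket (bracket h x) y + bracket x (bracket h y)"
proof -
  have "bracket h (bracket x y) = - bracket x (bracket y h) - bracket y (bracket h x)"
    using jacobi[of h x y] by (simp add: algebra_simps eq_neg_iff_add_eq_0)
  moreover have "bracket x (bracket y h) = - bracket x (bracket h y)"
    using bracket_anticommute[of y h] bracket_scale_right[of x "-1" "bracket h y"] by simp
  moreover have "bracket y (bracket h x) = - bracket (bracket h x) y"
    by (rule bracket_anticommute)
  ultimately show ?thesis by simp
qed

lemma subspace_weight_space: "subspace (weight_space H \<alpha>)"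
  unfolding weight_space_def
  by (rule subspaceI)
    (auto simp: bracket_zero_right bracket_add_right bracket_scale_right scale_right_distrib
      scale_left_commute)

lemma bracket_weight_space:
  assumes "x \<in> weight_space H \<alpha>" "y \<in> weight_space H \<beta>"
  shows "bracket x y \<in> weight_space H (\<alpha> + \<beta>)"
  using assms unfolding weight_space_def
  by (auto simp: bracket_derivation bracket_scale_left bracket_scale_right scale_left_distrib)

lemma zero_mem_dual: "0 \<in> dual H"
  unfolding dual_def by simp

lemma uminus_mem_dual: "\<alpha> \<in> dual H \<Longrightarrow> - \<alpha> \<in> dual H"
  unfolding dual_def by simp

lemma add_mem_dual: "\<alpha> \<in> dual H \<Longrightarrow> \<beta> \<in> dual H \<Longrightarrow> \<alpha> + \<beta> \<in> dual H"
  unfolding dual_def by (simp add: algebra_simps)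

lemma dual_separated:
  assumes "\<alpha> \<in> dual H" "\<beta> \<in> dual H" "\<alpha> \<noteq> \<beta>"
  shows "\<exists>h\<in>H. \<alpha> h \<noteq> \<beta> h"
proof (rule ccontr)
  assume "\<not> ?thesis"
  then have "\<alpha> x = \<beta> x" for x
    using assms(1,2) unfolding dual_def by (cases "x \<in> H") auto
  then show False using assms(3) by blast
qed

lemma free_additive_semigroup_add:
  assumes "free_additive_semigroup S" "a \<in> S" "b \<in> S"
  shows "a + b \<in> S"
proof -
  obtain B where B: "bij_betw sum_mset {M. M \<noteq> {#} \<and> set_mset M \<subseteq> B} S"
    using assms(1) unfolding free_additive_semigroup_def by blast
  then have S: "S = sum_mset ` {M. M \<noteq> {#} \<and> set_mset M \<subseteq> B}" by (simp add: bij_betw_def)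
  obtain M N where M: "M \<noteq> {#}" "set_mset M \<subseteq> B" "a = sum_mset M"
    and N: "N \<noteq> {#}" "set_mset N \<subseteq> B" "b = sum_mset N"
    using assms(2,3) unfolding S by auto
  have "a + b = sum_mset (M + N)" "M + N \<in> {M. M \<noteq> {#} \<and> set_mset M \<subseteq> B}"
    using M N by auto
  then show ?thesis unfolding S by (rule image_eqI)
qed

text \<open>The operator \<open>ad h - \<beta>(h)\<close> kills weight \<open>\<beta>\<close> and rescales every other weight \<open>\<alpha>\<close> by
  \<open>\<alpha>(h) - \<beta>(h)\<close>, which is nonzero for a suitable \<open>h\<close>; so the number of weights involved can be
  lowered without leaving an \<open>H\<close>-stable subspace. The case \<open>W = {0}\<close> is the linear independence of
  weight vectors of distinct weights, the case of a subalgebra containing \<open>H\<close> says that it is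
  graded.\<close>

lemma weight_parts_mem_stable_subspace:
  assumes "subspace W" and stable: "\<And>h w. h \<in> H \<Longrightarrow> w \<in> W \<Longrightarrow> bracket h w \<in> W"
    and "finite J" "J \<subseteq> dual H" "\<And>\<alpha>. \<alpha> \<in> J \<Longrightarrow> f \<alpha> \<in> weight_space H \<alpha>" "sum f J \<in> W"
  shows "\<forall>\<alpha>\<in>J. f \<alpha> \<in> W"
  using assms(3-6)
proof (induction J arbitrary: f rule: finite_induct)
  case empty
  then show ?case by simp
next
  case (insert \<beta> J)
  have others: "f \<alpha> \<in> W" if \<alpha>: "\<alpha> \<in> J" for \<alpha>
  proof -
    have "\<alpha> \<noteq> \<beta>" using \<alpha> insert.hyps by auto
    then obtain h where h: "h \<in> H" "\<alpha> h \<noteq> \<beta> h"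
      using dual_separated[of \<alpha> H \<beta>] \<alpha> insert.prems(1) by auto
    let ?w = "sum f (insert \<beta> J)"
    let ?g = "\<lambda>\<gamma>. scale (\<gamma> h - \<beta> h) (f \<gamma>)"
    have "bracket h ?w = (\<Sum>\<gamma>\<in>insert \<beta> J. scale (\<gamma> h) (f \<gamma>))"
      unfolding bracket_sum_right using insert.prems(2) h(1)
      by (intro sum.cong) (auto simp: weight_space_def)
    then have "bracket h ?w - scale (\<beta> h) ?w = (\<Sum>\<gamma>\<in>insert \<beta> J. ?g \<gamma>)"
      by (simp only: scale_sum_right scale_left_diff_distrib sum_subtractf)
    also have "\<dots> = sum ?g J"
      using insert.hyps by simp
    finally have "sum ?g J \<in> W"
      using stable[OF h(1) insert.prems(3)] insert.prems(3) \<open>subspace W\<close>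
      by (metis subspace_diff subspace_scale)
    moreover have "?g \<gamma> \<in> weight_space H \<gamma>" if "\<gamma> \<in> J" for \<gamma>
      using insert.prems(2)[of \<gamma>] that subspace_scale[OF subspace_weight_space] by auto
    ultimately have "?g \<alpha> \<in> W"
      using insert.IH[of ?g] insert.prems(1) \<open>\<alpha> \<in> J\<close> by auto
    then have "scale (inverse (\<alpha> h - \<beta> h)) (?g \<alpha>) \<in> W"
      using \<open>subspace W\<close> subspace_scale by blast
    then show ?thesis using h(2) by simp
  qed
  then have "sum f J \<in> W"
    using \<open>subspace W\<close> by (simp add: subspace_sum)
  moreover have "f \<beta> = sum f (insert \<beta> J) - sum f J"
    using insert.hyps by simp
  ultimately have "f \<beta> \<in> W"
    using insert.prems(3) \<open>subspace W\<close> subspace_diff by metis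
  then show ?case using others by blast
qed

lemma weight_vectors_independent:
  assumes "finite J" "J \<subseteq> dual H" "\<And>\<alpha>. \<alpha> \<in> J \<Longrightarrow> f \<alpha> \<in> weight_space H \<alpha>" "sum f J = 0"
    and "\<alpha> \<in> J"
  shows "f \<alpha> = 0"
  using weight_parts_mem_stable_subspace[of "{0}" H J f] assms
  by (simp add: bracket_zero_right)

section \<open>Linear algebra\<close>

text \<open>If \<open>V\<close> lies in \<open>W + span {v0}\<close>, where \<open>v0\<close> may lie outside \<open>V\<close>, then any element of \<open>V\<close>
  outside \<open>W\<close> can take the place of \<open>v0\<close>.\<close>

lemma corank_one_exchange:
  assumes W: "subspace W" and V: "subspace V" and v0: "\<And>v. v \<in> V \<Longrightarrow> \<exists>c. v - scale c v0 \<in> W"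
    and v1: "v1 \<in> V" "v1 \<notin> W" and v: "v \<in> V"
  shows "\<exists>c. v - scale c v1 \<in> W"
proof -
  obtain d where d: "v1 - scale d v0 \<in> W" using v0 v1(1) by blast
  obtain c where c: "v - scale c v0 \<in> W" using v0 v by blast
  have "d \<noteq> 0" using d v1(2) by auto
  have "v - scale (c / d) v1 = (v - scale c v0) - scale (c / d) (v1 - scale d v0)"
    using \<open>d \<noteq> 0\<close> by (simp add: scale_right_diff_distrib)
  then show ?thesis
    using c d W subspace_diff subspace_scale by metis
qed

lemma direct_sum_subspaces:
  assumes "direct_sum I W V" "\<And>i. i \<in> I \<Longrightarrow> subspace (U i)" "\<And>i. i \<in> I \<Longrightarrow> U i \<subseteq> W i"
  shows "direct_sum I U (span (\<Union>i\<in>I. U i))"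
  unfolding direct_sum_def
proof (intro conjI allI impI)
  fix J f
  assume *: "finite J \<and> J \<subseteq> I \<and> (\<forall>i\<in>J. f i \<in> U i) \<and> sum f J = 0"
  then have "\<forall>i\<in>J. f i \<in> W i" using assms(3) by blast
  then show "\<forall>i\<in>J. f i = 0"
    using * assms(1) unfolding direct_sum_def by blast
qed (use assms(2) in auto)

lemma direct_sum_list_three:
  "direct_sum_list [A, B, C] V \<longleftrightarrow> direct_sum {0, 1, 2} (\<lambda>i. [A, B, C] ! i) V"
proof -
  have "{..<length [A, B, C]} = {0, 1, 2}" by auto
  then show ?thesis unfolding direct_sum_list_def by simp
qed

lemma direct_sum_list_three_subspaces:
  assumes "direct_sum_list [A, B, C] V" "subspace A'" "subspace B'" "subspace C'"
    and "A' \<subseteq> A" "B' \<subseteq> B" "C' \<subseteq> C"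
  shows "direct_sum_list [A', B', C'] (span (A' \<union> B' \<union> C'))"
proof -
  have "(\<Union>i\<in>{0, 1, 2}. [A', B', C'] ! i) = A' \<union> B' \<union> C'" by auto
  moreover have "direct_sum {0, 1, 2} (\<lambda>i. [A', B', C'] ! i)
      (span (\<Union>i\<in>{0, 1, 2}. [A', B', C'] ! i))"
    using assms(1) unfolding direct_sum_list_three
    by (rule direct_sum_subspaces) (use assms in \<open>auto simp: numeral_2_eq_2\<close>)
  ultimately show ?thesis unfolding direct_sum_list_three by simp
qed

lemma span_three_subspaces:
  assumes "subspace A" "subspace B" "subspace C" "v \<in> span (A \<union> B \<union> C)"
  obtains a b c where "a \<in> A" "b \<in> B" "c \<in> C" "v = a + b + c"
proof -
  have "span (A \<union> B \<union> C) = {x + y |x y. x \<in> {x + y |x y. x \<in> A \<and> y \<in> B} \<and> y \<in> C}"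
    using assms(1-3) by (simp only: span_Un span_eq_iff[THEN iffD2])
  then show thesis using assms(4) that by auto
qed

text \<open>Comparing a basis \<open>B\<close> of \<open>s \<inter> H\<close> with one of \<open>H\<close> gives \<open>dim s \<le> |B| + 2 \<le> dim H + 2\<close>. In
  case of equality \<open>B\<close> is an independent subset of \<open>H\<close> with \<open>dim H\<close> elements, hence spans \<open>H\<close>.\<close>

lemma dim_span_insert_two:
  assumes H: "fin_dim H" and s: "s \<subseteq> span (insert x (insert y (s \<inter> H)))"
    and "subspace s"
  shows "dim s \<le> dim H + 2" and "dim s = dim H + 2 \<Longrightarrow> H \<subseteq> s"
proof -
  obtain C where C: "finite C" "H = span C" using H unfolding fin_dim_def by blast
  then have "subspace H" by simp
  obtain A where A: "A \<subseteq> H" "independent A" "H \<subseteq> span A" "card A = dim H"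
    by (rule basis_exists)
  have finA: "finite A" using independent_span_bound[OF C(1) A(2)] A(1) C(2) by blast
  obtain B where B: "B \<subseteq> s \<inter> H" "independent B" "s \<inter> H \<subseteq> span B"
    by (rule basis_exists)
  have BA: "finite B \<and> card B \<le> card A"
    using independent_span_bound[OF finA B(2)] B(1) A(3) by blast
  have "insert x (insert y (s \<inter> H)) \<subseteq> span (insert x (insert y B))"
    using B(3) span_mono[of B "insert x (insert y B)"] by (auto intro: span_base)
  then have "s \<subseteq> span (insert x (insert y B))"
    using s span_minimal[OF _ subspace_span] by blast
  then have "dim s \<le> card (insert x (insert y B))"
    using BA by (intro dim_le_card) auto
  also have "\<dots> \<le> card B + 2"
    using card_insert_le_m1 BA by (simp add: card_insert_if)
  finally have dim: "dim s \<le> card B + 2" .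
  then show "dim s \<le> dim H + 2" using BA A(4) by simp
  assume "dim s = dim H + 2"
  then have "card A \<le> card B" using dim A(4) by simp
  have "H \<subseteq> span B"
  proof
    fix h assume "h \<in> H"
    show "h \<in> span B"
    proof (rule ccontr)
      assume "h \<notin> span B"
      then have "independent (insert h B)" "h \<notin> B" using B(2) independent_insertI span_base by auto
      moreover have "insert h B \<subseteq> span A" using \<open>h \<in> H\<close> A(3) B(1) by auto
      ultimately have "card (insert h B) \<le> card A" using independent_span_bound[OF finA] by blast
      then show False using \<open>card A \<le> card B\<close> \<open>h \<notin> B\<close> BA by simp
    qed
  qed
  also have "span B \<subseteq> s" using B(1) \<open>subspace s\<close> by (simp add: span_minimal)
  finally show "H \<subseteq> s" .
qed

end

section \<open>Components of a vector\<close>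

text \<open>A weakly triangular decomposition with a chosen anti-involution \<open>\<sigma>\<close> and a chosen order;
  as in the definition, \<open>(\<beta>, \<alpha>) \<in> r\<close> stands for \<open>\<alpha> \<ge> \<beta>\<close>.\<close>

locale weakly_triangular_algebra = lie_algebra scale bracket
  for scale :: "'f::field \<Rightarrow> 'v::ab_group_add \<Rightarrow> 'v" and bracket :: "'v \<Rightarrow> 'v \<Rightarrow> 'v" +
  fixes Lminus H Lplus :: "'v set" and Gplus :: "('v \<Rightarrow> 'f) set" and \<sigma> :: "'v \<Rightarrow> 'v"
    and r :: "('v \<Rightarrow> 'f) rel"
  assumes subspace_Lminus: "subspace Lminus"
    and subspace_H: "subspace H"
    and subspace_Lplus: "subspace Lplus"
    and direct_sum_UNIV: "direct_sum_list [Lminus, H, Lplus] UNIV"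
    and bracket_H: "\<And>x y. x \<in> H \<Longrightarrow> y \<in> H \<Longrightarrow> bracket x y = 0"
    and Gplus_dual: "Gplus \<subseteq> dual H"
    and Gplus_add: "\<And>\<alpha> \<beta>. \<alpha> \<in> Gplus \<Longrightarrow> \<beta> \<in> Gplus \<Longrightarrow> \<alpha> + \<beta> \<in> Gplus"
    and Lplus_span: "Lplus = span (\<Union>\<alpha>\<in>Gplus - {0}. Lplus \<inter> weight_space H \<alpha>)"
    and anti_involution: "anti_involution \<sigma>"
    and sigma_Lplus: "\<sigma> ` Lplus = Lminus"
    and sigma_H: "\<And>h. h \<in> H \<Longrightarrow> \<sigma> h = h"
    and order: "linear_order_on Gplus r"
    and order_add: "\<And>\<alpha> \<beta>. \<alpha> \<in> Gplus \<Longrightarrow> \<beta> \<in> Gplus \<Longrightarrow> (\<alpha>, \<alpha> + \<beta>) \<in> r"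
    and add_neq: "\<And>\<alpha> \<beta>. \<alpha> \<in> Gplus \<Longrightarrow> \<beta> \<in> Gplus \<Longrightarrow> \<alpha> + \<beta> \<noteq> \<alpha>"
    and add_mono: "\<And>\<alpha> \<beta> \<gamma>. \<alpha> \<in> Gplus \<Longrightarrow> \<beta> \<in> Gplus \<Longrightarrow> \<gamma> \<in> Gplus \<Longrightarrow> (\<gamma>, \<beta>) \<in> r
      \<Longrightarrow> (\<alpha> + \<gamma>, \<alpha> + \<beta>) \<in> r"
begin

lemma zero_notin_Gplus: "0 \<notin> Gplus"
  using add_neq[of 0 0] by auto

lemma sigma_add: "\<sigma> (x + y) = \<sigma> x + \<sigma> y"
  and sigma_scale: "\<sigma> (scale c x) = scale c (\<sigma> x)"
  and sigma_bracket: "\<sigma> (bracket x y) = bracket (\<sigma> y) (\<sigma> x)"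
  and sigma_sigma [simp]: "\<sigma> (\<sigma> x) = x"
  using anti_involution unfolding anti_involution_def linear_iff by auto

lemma sigma_zero [simp]: "\<sigma> 0 = 0"
  using sigma_add[of 0 0] by simp

lemma sigma_diff: "\<sigma> (x - y) = \<sigma> x - \<sigma> y"
  using sigma_add[of "x - y" y] by (simp add: algebra_simps)

lemma sigma_sum: "\<sigma> (sum f J) = (\<Sum>i\<in>J. \<sigma> (f i))"
  by (induction J rule: infinite_finite_induct) (simp_all add: sigma_add)

lemma sigma_eq_zero_iff [simp]: "\<sigma> x = 0 \<longleftrightarrow> x = 0"
  by (metis sigma_sigma sigma_zero)

lemma sigma_weight_space:
  assumes "x \<in> weight_space H \<alpha>"
  shows "\<sigma> x \<in> weight_space H (- \<alpha>)"
  unfolding weight_space_def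
proof (intro CollectI ballI)
  fix h assume "h \<in> H"
  have "bracket h (\<sigma> x) = \<sigma> (bracket x h)"
    using sigma_H[OF \<open>h \<in> H\<close>] by (simp add: sigma_bracket)
  also have "bracket x h = scale (- \<alpha> h) x"
    using assms \<open>h \<in> H\<close> bracket_anticommute[of x h] by (simp add: weight_space_def)
  finally show "bracket h (\<sigma> x) = scale ((- \<alpha>) h) (\<sigma> x)"
    by (simp only: sigma_scale uminus_apply)
qed

text \<open>The family \<open>f\<close> ranges over the whole dual of \<open>H\<close> rather than over \<open>0\<close> and \<open>\<plusminus>Gplus\<close>, because
  the bracket of two weight vectors has the sum of their weights, which may lie outside that set.
  Functionals are required to vanish off \<open>H\<close>, since functions agreeing on \<open>H\<close> define the
  same weight space and uniqueness would fail otherwise.\<close>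

definition weight_decomposition :: "(('v \<Rightarrow> 'f) \<Rightarrow> 'v) \<Rightarrow> 'v \<Rightarrow> bool" where
  "weight_decomposition f v \<longleftrightarrow>
     finite {\<gamma>. f \<gamma> \<noteq> 0} \<and> (\<forall>\<gamma>. f \<gamma> \<in> weight_space H \<gamma>) \<and> (\<forall>\<gamma>. \<gamma> \<notin> dual H \<longrightarrow> f \<gamma> = 0) \<and>
     v = (\<Sum>\<gamma> | f \<gamma> \<noteq> 0. f \<gamma>)"

definition component :: "'v \<Rightarrow> ('v \<Rightarrow> 'f) \<Rightarrow> 'v" where
  "component v = (THE f. weight_decomposition f v)"

lemma weight_decomposition_sum:
  assumes "weight_decomposition f v" "finite J" "{\<gamma>. f \<gamma> \<noteq> 0} \<subseteq> J"
  shows "v = sum f J"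
proof -
  have "(\<Sum>\<gamma> | f \<gamma> \<noteq> 0. f \<gamma>) = sum f J"
    using assms(2,3) by (intro sum.mono_neutral_left) auto
  then show ?thesis using assms(1) unfolding weight_decomposition_def by metis
qed

lemma weight_decompositionI:
  assumes "finite J" "\<And>\<gamma>. \<gamma> \<notin> J \<Longrightarrow> f \<gamma> = 0" "J \<subseteq> dual H"
    "\<And>\<gamma>. \<gamma> \<in> J \<Longrightarrow> f \<gamma> \<in> weight_space H \<gamma>" "v = sum f J"
  shows "weight_decomposition f v"
proof -
  have "{\<gamma>. f \<gamma> \<noteq> 0} \<subseteq> J" using assms(2) by blast
  then have "finite {\<gamma>. f \<gamma> \<noteq> 0}" "sum f J = (\<Sum>\<gamma> | f \<gamma> \<noteq> 0. f \<gamma>)"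
    using assms(1) by (auto intro: finite_subset sum.mono_neutral_right)
  moreover have "f \<gamma> \<in> weight_space H \<gamma>" for \<gamma>
    using assms(2,4) subspace_0[OF subspace_weight_space, of H \<gamma>] by (cases "\<gamma> \<in> J") auto
  ultimately show ?thesis
    using assms(2,3,5) unfolding weight_decomposition_def by auto
qed

lemma weight_decomposition_single:
  assumes "\<gamma> \<in> dual H" "v \<in> weight_space H \<gamma>"
  shows "weight_decomposition (\<lambda>\<delta>. if \<delta> = \<gamma> then v else 0) v"
  by (rule weight_decompositionI[where J = "{\<gamma>}"]) (use assms in auto)

lemma weight_decomposition_add:
  assumes f: "weight_decomposition f u" and g: "weight_decomposition g v"
  shows "weight_decomposition (\<lambda>\<gamma>. f \<gamma> + g \<gamma>) (u + v)"
proof -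
  let ?J = "{\<gamma>. f \<gamma> \<noteq> 0} \<union> {\<gamma>. g \<gamma> \<noteq> 0}"
  have fin: "finite ?J" using f g by (simp add: weight_decomposition_def)
  have "u = sum f ?J" "v = sum g ?J"
    using weight_decomposition_sum[OF f fin] weight_decomposition_sum[OF g fin] by auto
  then show ?thesis
    using f g fin
    by (intro weight_decompositionI[where J = ?J])
      (auto simp: sum.distrib weight_decomposition_def intro: subspace_add[OF subspace_weight_space])
qed

lemma weight_decomposition_scale:
  assumes f: "weight_decomposition f u"
  shows "weight_decomposition (\<lambda>\<gamma>. scale c (f \<gamma>)) (scale c u)"
proof -
  let ?J = "{\<gamma>. f \<gamma> \<noteq> 0}"
  show ?thesis
    using f weight_decomposition_sum[OF f, of ?J]
    by (intro weight_decompositionI[where J = ?J])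
      (auto simp: scale_sum_right weight_decomposition_def
        intro: subspace_scale[OF subspace_weight_space])
qed

lemma weight_decomposition_unique:
  assumes f: "weight_decomposition f v" and g: "weight_decomposition g v"
  shows "f = g"
proof
  fix \<gamma>
  have d: "weight_decomposition (\<lambda>\<gamma>. f \<gamma> + scale (- 1) (g \<gamma>)) (v + scale (- 1) v)"
    by (intro weight_decomposition_add weight_decomposition_scale f g)
  let ?d = "\<lambda>\<gamma>. f \<gamma> + scale (- 1) (g \<gamma>)"
  let ?J = "{\<gamma>. ?d \<gamma> \<noteq> 0}"
  have "\<gamma> \<notin> ?J"
  proof
    assume "\<gamma> \<in> ?J"
    moreover have "finite ?J" "?J \<subseteq> dual H" "sum ?d ?J = 0"
        "\<And>\<gamma>. \<gamma> \<in> ?J \<Longrightarrow> ?d \<gamma> \<in> weight_space H \<gamma>"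
      using d unfolding weight_decomposition_def by auto
    ultimately have "?d \<gamma> = 0"
      using weight_vectors_independent[of ?J H ?d] by blast
    then show False using \<open>\<gamma> \<in> ?J\<close> by simp
  qed
  then show "f \<gamma> = g \<gamma>" by simp
qed

lemma component_eq: "weight_decomposition f v \<Longrightarrow> component v = f"
  unfolding component_def by (blast intro: the_equality weight_decomposition_unique)

lemma weight_decomposition_Lplus:
  assumes "p \<in> Lplus"
  shows "\<exists>f. weight_decomposition f p \<and> (\<forall>\<gamma>. f \<gamma> \<in> Lplus) \<and> (\<forall>\<gamma>. \<gamma> \<notin> Gplus \<longrightarrow> f \<gamma> = 0)"
proof -
  let ?Q = "\<lambda>p f. weight_decomposition f p \<and> (\<forall>\<gamma>. f \<gamma> \<in> Lplus) \<and> (\<forall>\<gamma>. \<gamma> \<notin> Gplus \<longrightarrow> f \<gamma> = 0)"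
  have "subspace {p. \<exists>f. ?Q p f}"
  proof (rule subspaceI)
    show "0 \<in> {p. \<exists>f. ?Q p f}"
      using weight_decompositionI[of "{}" "\<lambda>_. 0" 0] subspace_0[OF subspace_Lplus] by auto
  next
    fix x y assume "x \<in> {p. \<exists>f. ?Q p f}" "y \<in> {p. \<exists>f. ?Q p f}"
    then obtain f g where "?Q x f" "?Q y g" by blast
    then have "?Q (x + y) (\<lambda>\<gamma>. f \<gamma> + g \<gamma>)"
      using weight_decomposition_add subspace_add[OF subspace_Lplus] by simp
    then show "x + y \<in> {p. \<exists>f. ?Q p f}" by blast
  next
    fix c x assume "x \<in> {p. \<exists>f. ?Q p f}"
    then obtain f where "?Q x f" by blast
    then have "?Q (scale c x) (\<lambda>\<gamma>. scale c (f \<gamma>))"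
      using weight_decomposition_scale subspace_scale[OF subspace_Lplus] by simp
    then show "scale c x \<in> {p. \<exists>f. ?Q p f}" by blast
  qed
  moreover have "(\<Union>\<alpha>\<in>Gplus - {0}. Lplus \<inter> weight_space H \<alpha>) \<subseteq> {p. \<exists>f. ?Q p f}"
  proof
    fix v assume "v \<in> (\<Union>\<alpha>\<in>Gplus - {0}. Lplus \<inter> weight_space H \<alpha>)"
    then obtain \<alpha> where "\<alpha> \<in> Gplus" "v \<in> Lplus" "v \<in> weight_space H \<alpha>" by blast
    then have "?Q v (\<lambda>\<delta>. if \<delta> = \<alpha> then v else 0)"
      using weight_decomposition_single[of \<alpha> v] Gplus_dual subspace_0[OF subspace_Lplus] by auto
    then show "v \<in> {p. \<exists>f. ?Q p f}" by blast
  qed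
  ultimately have "span (\<Union>\<alpha>\<in>Gplus - {0}. Lplus \<inter> weight_space H \<alpha>) \<subseteq> {p. \<exists>f. ?Q p f}"
    using span_minimal by blast
  then show ?thesis using assms Lplus_span by auto
qed

lemma weight_decomposition_sigma:
  assumes f: "weight_decomposition f v"
  shows "weight_decomposition (\<lambda>\<gamma>. \<sigma> (f (- \<gamma>))) (\<sigma> v)"
proof -
  let ?J = "{\<gamma>. f \<gamma> \<noteq> 0}"
  have "\<sigma> v = (\<Sum>\<gamma>\<in>?J. \<sigma> (f \<gamma>))"
    using weight_decomposition_sum[OF f, of ?J] f sigma_sum
    unfolding weight_decomposition_def by auto
  also have "\<dots> = (\<Sum>\<gamma>\<in>uminus ` ?J. \<sigma> (f (- \<gamma>)))"
    by (subst sum.reindex) auto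
  finally have s: "\<sigma> v = (\<Sum>\<gamma>\<in>uminus ` ?J. \<sigma> (f (- \<gamma>)))" .
  show ?thesis
  proof (rule weight_decompositionI[OF _ _ _ _ s])
    show "finite (uminus ` ?J)" using f by (simp add: weight_decomposition_def)
    show "\<sigma> (f (- \<gamma>)) = 0" if "\<gamma> \<notin> uminus ` ?J" for \<gamma>
      using that by (force simp: image_iff)
    show "uminus ` ?J \<subseteq> dual H"
      using f by (auto simp: weight_decomposition_def intro: uminus_mem_dual)
    show "\<sigma> (f (- \<gamma>)) \<in> weight_space H \<gamma>" if "\<gamma> \<in> uminus ` ?J" for \<gamma>
      using f sigma_weight_space[of "f (- \<gamma>)" "- \<gamma>"] by (simp add: weight_decomposition_def)
  qed
qed

lemma triangular_decomposition:
  obtains m h p where "m \<in> Lminus" "h \<in> H" "p \<in> Lplus" "v = m + h + p"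
proof -
  have "(\<Union>i\<in>{0, 1, 2}. [Lminus, H, Lplus] ! i) = Lminus \<union> H \<union> Lplus" by auto
  then have "v \<in> span (Lminus \<union> H \<union> Lplus)"
    using direct_sum_UNIV unfolding direct_sum_list_three direct_sum_def by simp
  then show thesis
    using span_three_subspaces subspace_Lminus subspace_H subspace_Lplus that by metis
qed

lemma H_subset_weight_space: "H \<subseteq> weight_space H 0"
  using bracket_H by (auto simp: weight_space_def)

lemma ex_weight_decomposition: "\<exists>f. weight_decomposition f v"
proof -
  obtain m h p where v: "m \<in> Lminus" "h \<in> H" "p \<in> Lplus" "v = m + h + p"
    by (rule triangular_decomposition)
  obtain p' where "p' \<in> Lplus" "m = \<sigma> p'" using v(1) sigma_Lplus by blast
  then show ?thesis
    using v weight_decomposition_Lplus[of p] weight_decomposition_Lplus[of p']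
      weight_decomposition_sigma weight_decomposition_add
      weight_decomposition_single[OF zero_mem_dual, of h] H_subset_weight_space
    by (metis subsetD)
qed

lemma weight_decomposition_component: "weight_decomposition (component v) v"
  using ex_weight_decomposition component_eq by metis

lemma component_add: "component (u + v) \<gamma> = component u \<gamma> + component v \<gamma>"
  using component_eq[OF weight_decomposition_add[OF weight_decomposition_component[of u]
        weight_decomposition_component[of v]]] by simp

lemma component_scale: "component (scale c v) \<gamma> = scale c (component v \<gamma>)"
  using component_eq[OF weight_decomposition_scale[OF weight_decomposition_component[of v]]] by simp

lemma component_zero [simp]: "component 0 \<gamma> = 0"
  using component_add[of 0 0 \<gamma>] by simp

lemma component_diff: "component (u - v) \<gamma> = component u \<gamma> - component v \<gamma>"
  using component_add[of "u - v" v \<gamma>] by (simp add: algebra_simps)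

lemma component_sum: "component (sum f J) \<gamma> = (\<Sum>i\<in>J. component (f i) \<gamma>)"
  by (induction J rule: infinite_finite_induct) (simp_all add: component_add)

lemma component_sigma: "component (\<sigma> v) \<gamma> = \<sigma> (component v (- \<gamma>))"
  using component_eq[OF weight_decomposition_sigma[OF weight_decomposition_component]] by simp

lemma component_weight_vector:
  assumes "\<alpha> \<in> dual H" "v \<in> weight_space H \<alpha>"
  shows "component v \<gamma> = (if \<gamma> = \<alpha> then v else 0)"
  using component_eq[OF weight_decomposition_single[OF assms]] by simp

lemma finite_component_support: "finite {\<gamma>. component v \<gamma> \<noteq> 0}"
  and component_mem: "component v \<gamma> \<in> weight_space H \<gamma>"
  and component_mem_dual: "component v \<gamma> \<noteq> 0 \<Longrightarrow> \<gamma> \<in> dual H"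
  and component_sum_eq: "(\<Sum>\<gamma> | component v \<gamma> \<noteq> 0. component v \<gamma>) = v"
  using weight_decomposition_component[of v] unfolding weight_decomposition_def by auto

lemma component_eq_zeroD: "(\<And>\<gamma>. component v \<gamma> = 0) \<Longrightarrow> v = 0"
  using component_sum_eq[of v] by simp

lemma component_Lplus:
  assumes "p \<in> Lplus"
  shows "component p \<gamma> \<in> Lplus" "\<gamma> \<notin> Gplus \<Longrightarrow> component p \<gamma> = 0"
  using weight_decomposition_Lplus[OF assms] component_eq by auto

lemma component_H:
  assumes "h \<in> H" "\<gamma> \<noteq> 0"
  shows "component h \<gamma> = 0"
  using component_weight_vector[OF zero_mem_dual, of h \<gamma>] assms H_subset_weight_space by auto

lemma component_Lminus:
  assumes "m \<in> Lminus" "- \<gamma> \<notin> Gplus"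
  shows "component m \<gamma> = 0"
proof -
  obtain p where "p \<in> Lplus" "m = \<sigma> p" using assms(1) sigma_Lplus by blast
  then show ?thesis using component_Lplus(2)[of p "- \<gamma>"] assms(2) by (simp add: component_sigma)
qed

lemma Gplus_uminus_disjoint:
  assumes "\<gamma> \<in> Gplus"
  shows "- \<gamma> \<notin> Gplus"
  using Gplus_add[OF assms, of "- \<gamma>"] zero_notin_Gplus by auto

lemma component_triangular:
  assumes "m \<in> Lminus" "h \<in> H" "p \<in> Lplus" "\<gamma> \<in> Gplus"
  shows "component (m + h + p) \<gamma> = component p \<gamma>"
    and "component (m + h + p) (- \<gamma>) = component m (- \<gamma>)"
proof -
  have "\<gamma> \<noteq> 0" "- \<gamma> \<noteq> 0" using assms(4) zero_notin_Gplus by auto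
  then show "component (m + h + p) \<gamma> = component p \<gamma>"
    and "component (m + h + p) (- \<gamma>) = component m (- \<gamma>)"
    using assms Gplus_uminus_disjoint[OF assms(4)] component_H[OF assms(2)]
      component_Lminus[OF assms(1), of \<gamma>] component_Lplus(2)[OF assms(3), of "- \<gamma>"]
    by (auto simp: component_add)
qed

lemma component_Gplus_mem_Lplus:
  assumes "\<gamma> \<in> Gplus"
  shows "component v \<gamma> \<in> Lplus"
proof -
  obtain m h p where v: "m \<in> Lminus" "h \<in> H" "p \<in> Lplus" "v = m + h + p"
    by (rule triangular_decomposition)
  then show ?thesis
    using component_triangular(1)[OF v(1-3) assms] component_Lplus(1)[OF v(3)] by simp
qed

lemma component_support_cases:
  assumes "component v \<gamma> \<noteq> 0"
  shows "\<gamma> \<in> Gplus \<or> \<gamma> = 0 \<or> - \<gamma> \<in> Gplus"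
proof -
  obtain m h p where v: "m \<in> Lminus" "h \<in> H" "p \<in> Lplus" "v = m + h + p"
    by (rule triangular_decomposition)
  show ?thesis
  proof (rule ccontr)
    assume "\<not> ?thesis"
    then have "component m \<gamma> = 0" "component h \<gamma> = 0" "component p \<gamma> = 0"
      using component_Lminus[OF v(1)] component_H[OF v(2)] component_Lplus(2)[OF v(3)] by blast+
    then show False using assms v(4) by (simp add: component_add)
  qed
qed

lemma mem_Lplus_component_zero:
  assumes "p \<in> Lplus" "\<And>\<gamma>. \<gamma> \<in> Gplus \<Longrightarrow> component p \<gamma> = 0"
  shows "p = 0"
  by (rule component_eq_zeroD) (use assms component_Lplus(2) in blast)

lemma mem_Lminus_component_zero:
  assumes "m \<in> Lminus" "\<And>\<gamma>. \<gamma> \<in> Gplus \<Longrightarrow> component m (- \<gamma>) = 0"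
  shows "m = 0"
  by (rule component_eq_zeroD) (use assms component_Lminus in \<open>metis minus_minus\<close>)

lemma mem_H_if_components_zero:
  assumes "\<And>\<gamma>. \<gamma> \<in> Gplus \<Longrightarrow> component v \<gamma> = 0" "\<And>\<gamma>. \<gamma> \<in> Gplus \<Longrightarrow> component v (- \<gamma>) = 0"
  shows "v \<in> H"
proof -
  obtain m h p where v: "m \<in> Lminus" "h \<in> H" "p \<in> Lplus" "v = m + h + p"
    by (rule triangular_decomposition)
  have "p = 0"
    using mem_Lplus_component_zero[OF v(3)] component_triangular(1)[OF v(1-3)] assms(1) v(4) by auto
  moreover have "m = 0"
    using mem_Lminus_component_zero[OF v(1)] component_triangular(2)[OF v(1-3)] assms(2) v(4)
    by auto
  ultimately show ?thesis using v by simp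
qed

lemma weight_space_zero_eq_H: "weight_space H 0 = H"
proof
  show "weight_space H 0 \<subseteq> H"
  proof
    fix v assume v: "v \<in> weight_space H 0"
    have "component v \<gamma> = 0" if "\<gamma> \<noteq> 0" for \<gamma>
      using component_weight_vector[OF zero_mem_dual v, of \<gamma>] that by simp
    then show "v \<in> H"
      using mem_H_if_components_zero[of v] zero_notin_Gplus by (metis neg_equal_0_iff_equal)
  qed
qed (rule H_subset_weight_space)

section \<open>Leading terms\<close>

lemma order_antisym: "(\<alpha>, \<beta>) \<in> r \<Longrightarrow> (\<beta>, \<alpha>) \<in> r \<Longrightarrow> \<alpha> = \<beta>"
  using order unfolding order_on_defs by (blast dest: antisymD)

lemma order_trans: "(\<alpha>, \<beta>) \<in> r \<Longrightarrow> (\<beta>, \<gamma>) \<in> r \<Longrightarrow> (\<alpha>, \<gamma>) \<in> r"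
  using order unfolding order_on_defs by (blast dest: transD)

lemma order_refl: "\<alpha> \<in> Gplus \<Longrightarrow> (\<alpha>, \<alpha>) \<in> r"
  using order unfolding order_on_defs by (blast dest: refl_onD)

lemma order_total: "\<alpha> \<in> Gplus \<Longrightarrow> \<beta> \<in> Gplus \<Longrightarrow> (\<alpha>, \<beta>) \<in> r \<or> (\<beta>, \<alpha>) \<in> r"
  using order order_refl unfolding order_on_defs total_on_def by metis

lemma ex_greatest_weight:
  assumes "finite D" "D \<noteq> {}" "D \<subseteq> Gplus"
  shows "\<exists>\<alpha>\<in>D. \<forall>\<beta>\<in>D. (\<beta>, \<alpha>) \<in> r"
  using assms
proof (induction D rule: finite_ne_induct)
  case (singleton x)
  then show ?case using order_refl by auto
next
  case (insert x F)
  then obtain \<alpha> where \<alpha>: "\<alpha> \<in> F" "\<And>\<beta>. \<beta> \<in> F \<Longrightarrow> (\<beta>, \<alpha>) \<in> r" by auto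
  have G: "x \<in> Gplus" "\<alpha> \<in> Gplus" using \<alpha>(1) insert.prems by auto
  show ?case
  proof (cases "(x, \<alpha>) \<in> r")
    case True
    then show ?thesis using \<alpha> by blast
  next
    case False
    then have "(\<alpha>, x) \<in> r" using order_total[OF G] by blast
    then show ?thesis using \<alpha>(2) order_trans order_refl[OF G(1)] by blast
  qed
qed

text \<open>The order is given on \<open>Gplus\<close> only. Were \<open>\<gamma>\<close> positive and \<open>\<delta>\<close> not, then
  \<open>\<gamma> = \<alpha> + (\<beta> - \<delta>)\<close> with \<open>\<beta> - \<delta> \<in> Gplus\<close> would exceed \<open>\<alpha>\<close>; were both not positive, \<open>0\<close> would lie
  in \<open>Gplus\<close>. If both are positive, monotonicity of addition applies.\<close>

lemma leading_weights_unique: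
  assumes \<alpha>: "\<alpha> \<in> Gplus" and \<beta>: "\<beta> \<in> Gplus"
    and \<gamma>: "\<gamma> \<in> Gplus \<or> \<gamma> = 0 \<or> - \<gamma> \<in> Gplus" "\<gamma> \<in> Gplus \<Longrightarrow> (\<gamma>, \<alpha>) \<in> r"
    and \<delta>: "\<delta> \<in> Gplus \<or> \<delta> = 0 \<or> - \<delta> \<in> Gplus" "\<delta> \<in> Gplus \<Longrightarrow> (\<delta>, \<beta>) \<in> r"
    and eq: "\<gamma> + \<delta> = \<alpha> + \<beta>"
  shows "\<gamma> = \<alpha> \<and> \<delta> = \<beta>"
proof -
  have minus: "\<epsilon> - \<nu> \<in> Gplus" if "\<epsilon> \<in> Gplus" "\<nu> = 0 \<or> - \<nu> \<in> Gplus" for \<epsilon> \<nu>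
    using that Gplus_add[of \<epsilon> "- \<nu>"] by auto
  have not_above: False if "\<epsilon> \<in> Gplus" "\<zeta> \<in> Gplus" "\<nu> = 0 \<or> - \<nu> \<in> Gplus" "\<kappa> + \<nu> = \<epsilon> + \<zeta>" "(\<kappa>, \<epsilon>) \<in> r"
    for \<epsilon> \<zeta> \<nu> \<kappa>
  proof -
    have "\<kappa> = \<epsilon> + (\<zeta> - \<nu>)" using that(4) by (metis add_diff_cancel_right' add_diff_eq)
    then show False
      using that(1,5) minus[OF that(2,3)] order_add[of \<epsilon> "\<zeta> - \<nu>"] add_neq[of \<epsilon> "\<zeta> - \<nu>"] order_antisym
      by metis
  qed
  consider "\<gamma> \<in> Gplus" "\<delta> \<in> Gplus" | "\<gamma> \<in> Gplus" "\<delta> = 0 \<or> - \<delta> \<in> Gplus"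
    | "\<gamma> = 0 \<or> - \<gamma> \<in> Gplus" "\<delta> \<in> Gplus" | "\<gamma> = 0 \<or> - \<gamma> \<in> Gplus" "\<delta> = 0 \<or> - \<delta> \<in> Gplus"
    using \<gamma>(1) \<delta>(1) by blast
  then show ?thesis
  proof cases
    case 1
    have "(\<gamma> + \<delta>, \<gamma> + \<beta>) \<in> r" using add_mono[of \<gamma> \<beta> \<delta>] 1 \<beta> \<delta>(2) by blast
    moreover have "(\<beta> + \<gamma>, \<beta> + \<alpha>) \<in> r" using add_mono[of \<beta> \<alpha> \<gamma>] 1 \<alpha> \<beta> \<gamma>(2) by blast
    ultimately have "\<gamma> + \<delta> = \<gamma> + \<beta>" using eq order_antisym by (metis add.commute)
    then show ?thesis using eq by simp
  next
    case 2
    then show ?thesis using not_above[of \<alpha> \<beta> \<delta> \<gamma>] \<alpha> \<beta> \<gamma>(2) eq by blast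
  next
    case 3
    then show ?thesis using not_above[of \<beta> \<alpha> \<gamma> \<delta>] \<alpha> \<beta> \<delta>(2) eq by (metis add.commute)
  next
    case 4
    have "(\<alpha> + \<beta> - \<gamma>) - \<delta> \<in> Gplus"
      using minus[OF minus[OF Gplus_add[OF \<alpha> \<beta>] 4(1)] 4(2)] .
    moreover have "(\<alpha> + \<beta> - \<gamma>) - \<delta> = 0"
      using eq by (metis add_diff_cancel_left' cancel_comm_monoid_add_class.diff_cancel)
    ultimately show ?thesis using zero_notin_Gplus by simp
  qed
qed

text \<open>Expanding both factors into components, only the pair \<open>(\<alpha>, \<beta>)\<close> contributes to the weight
  \<open>\<alpha> + \<beta>\<close>.\<close>

lemma component_bracket_leading:
  assumes "\<And>\<gamma> \<delta>. component x \<gamma> \<noteq> 0 \<Longrightarrow> component y \<delta> \<noteq> 0 \<Longrightarrow> \<gamma> + \<delta> = \<alpha> + \<beta> \<Longrightarrow> \<gamma> = \<alpha> \<and> \<delta> = \<beta>"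
    and x: "component x \<alpha> \<noteq> 0" and y: "component y \<beta> \<noteq> 0"
  shows "component (bracket x y) (\<alpha> + \<beta>) = bracket (component x \<alpha>) (component y \<beta>)"
proof -
  let ?S = "\<lambda>v. {\<gamma>. component v \<gamma> \<noteq> 0}"
  let ?b = "\<lambda>\<gamma> \<delta>. bracket (component x \<gamma>) (component y \<delta>)"
  have "bracket x y = bracket (\<Sum>\<gamma>\<in>?S x. component x \<gamma>) (\<Sum>\<delta>\<in>?S y. component y \<delta>)"
    by (simp only: component_sum_eq)
  also have "\<dots> = (\<Sum>\<gamma>\<in>?S x. \<Sum>\<delta>\<in>?S y. ?b \<gamma> \<delta>)"
    by (simp only: bracket_sum_left) (simp only: bracket_sum_right)
  finally have "component (bracket x y) (\<alpha> + \<beta>)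
      = (\<Sum>\<gamma>\<in>?S x. \<Sum>\<delta>\<in>?S y. component (?b \<gamma> \<delta>) (\<alpha> + \<beta>))"
    by (simp only: component_sum)
  also have "\<dots> = (\<Sum>\<gamma>\<in>?S x. \<Sum>\<delta>\<in>?S y. if \<gamma> = \<alpha> then if \<delta> = \<beta> then ?b \<alpha> \<beta> else 0 else 0)"
  proof (intro sum.cong refl)
    fix \<gamma> \<delta> assume *: "\<gamma> \<in> ?S x" "\<delta> \<in> ?S y"
    have "component (?b \<gamma> \<delta>) (\<alpha> + \<beta>) = (if \<alpha> + \<beta> = \<gamma> + \<delta> then ?b \<gamma> \<delta> else 0)"
      using * component_mem_dual[of x \<gamma>] component_mem_dual[of y \<delta>]
      by (intro component_weight_vector add_mem_dual bracket_weight_space component_mem) auto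
    then show "component (?b \<gamma> \<delta>) (\<alpha> + \<beta>)
        = (if \<gamma> = \<alpha> then if \<delta> = \<beta> then ?b \<alpha> \<beta> else 0 else 0)"
      using assms(1)[of \<gamma> \<delta>] * by auto
  qed
  also have "\<dots> = (\<Sum>\<gamma>\<in>?S x. if \<gamma> = \<alpha> then \<Sum>\<delta>\<in>?S y. if \<delta> = \<beta> then ?b \<alpha> \<beta> else 0 else 0)"
    by (intro sum.cong refl) simp
  also have "\<dots> = ?b \<alpha> \<beta>"
    using x y by (simp add: finite_component_support)
  finally show ?thesis .
qed

lemma finite_weights_fin_dim:
  assumes "fin_dim s"
  shows "finite {\<gamma>. \<exists>v\<in>s. component v \<gamma> \<noteq> 0}"
proof -
  obtain B where B: "finite B" "s = span B" using assms unfolding fin_dim_def by blast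
  let ?U = "\<Union>b\<in>B. {\<gamma>. component b \<gamma> \<noteq> 0}"
  have "subspace {v. \<forall>\<gamma>. \<gamma> \<notin> ?U \<longrightarrow> component v \<gamma> = 0}"
    by (rule subspaceI) (auto simp: component_add component_scale)
  then have "span B \<subseteq> {v. \<forall>\<gamma>. \<gamma> \<notin> ?U \<longrightarrow> component v \<gamma> = 0}"
    by (intro span_minimal) auto
  then have "{\<gamma>. \<exists>v\<in>s. component v \<gamma> \<noteq> 0} \<subseteq> ?U" using B(2) by blast
  then show ?thesis
    using B(1) finite_component_support by (meson finite_UN_I finite_subset)
qed

text \<open>The leading term argument: \<open>\<alpha>\<close> is the greatest positive weight of \<open>s\<close>, carried by \<open>x\<close>,
  and every element of \<open>s\<close> with a positive component turns out to have leading weight \<open>\<alpha>\<close> and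
  leading component proportional to that of \<open>x\<close>.\<close>

lemma positive_part_corank_one:
  assumes csc: "completely_self_centralizing Lplus" and s: "subalgebra s" "fin_dim s"
  shows "\<exists>x\<in>s. \<forall>y\<in>s. \<exists>c. \<forall>\<gamma>\<in>Gplus. component (y - scale c x) \<gamma> = 0"
proof -
  have sub: "subspace s" and closed: "\<And>x y. x \<in> s \<Longrightarrow> y \<in> s \<Longrightarrow> bracket x y \<in> s"
    using s(1) unfolding subalgebra_def by auto
  let ?D = "{\<gamma>\<in>Gplus. \<exists>v\<in>s. component v \<gamma> \<noteq> 0}"
  show ?thesis
  proof (cases "?D = {}")
    case True
    then have "\<forall>y\<in>s. \<forall>\<gamma>\<in>Gplus. component (y - scale 0 0) \<gamma> = 0" by auto
    then show ?thesis using subspace_0[OF sub] by blast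
  next
    case False
    have "finite ?D" using finite_weights_fin_dim[OF s(2)] by simp
    then obtain \<alpha> where \<alpha>: "\<alpha> \<in> ?D" "\<And>\<beta>. \<beta> \<in> ?D \<Longrightarrow> (\<beta>, \<alpha>) \<in> r"
      using ex_greatest_weight[OF _ False] by auto
    then obtain x where x: "x \<in> s" "component x \<alpha> \<noteq> 0" by auto
    have top: "\<exists>c. component y \<alpha> = scale c (component x \<alpha>) \<and> component y \<alpha> \<noteq> 0"
      if y: "y \<in> s" "\<beta>' \<in> Gplus" "component y \<beta>' \<noteq> 0" for y \<beta>'
    proof -
      let ?E = "{\<gamma>\<in>Gplus. component y \<gamma> \<noteq> 0}"
      have "finite ?E" using finite_component_support[of y] by simp
      moreover have "?E \<noteq> {}" using y by auto
      ultimately obtain \<beta> where \<beta>: "\<beta> \<in> ?E" "\<And>\<gamma>. \<gamma> \<in> ?E \<Longrightarrow> (\<gamma>, \<beta>) \<in> r"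
        using ex_greatest_weight[of ?E] by auto
      have G: "\<alpha> \<in> Gplus" "\<beta> \<in> Gplus" using \<alpha>(1) \<beta>(1) by auto
      have lead: "component (bracket x y) (\<alpha> + \<beta>) = bracket (component x \<alpha>) (component y \<beta>)"
      proof (rule component_bracket_leading[OF _ x(2)])
        show "component y \<beta> \<noteq> 0" using \<beta>(1) by simp
        fix \<gamma> \<delta> assume *: "component x \<gamma> \<noteq> 0" "component y \<delta> \<noteq> 0" "\<gamma> + \<delta> = \<alpha> + \<beta>"
        show "\<gamma> = \<alpha> \<and> \<delta> = \<beta>"
          by (rule leading_weights_unique[OF G component_support_cases[OF *(1)] _
                component_support_cases[OF *(2)] _ *(3)])
            (use * \<alpha>(2) \<beta>(2) x(1) in auto)
      qed
      have "component (bracket x y) (\<alpha> + \<beta>) = 0"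
      proof (rule ccontr)
        assume "component (bracket x y) (\<alpha> + \<beta>) \<noteq> 0"
        then have "(\<alpha> + \<beta>, \<alpha>) \<in> r"
          using \<alpha>(2)[of "\<alpha> + \<beta>"] closed[OF x(1) y(1)] Gplus_add[OF G] by blast
        then show False using order_add[OF G] add_neq[OF G] order_antisym by blast
      qed
      then have "bracket (component x \<alpha>) (component y \<beta>) = 0" using lead by simp
      then have "component y \<beta> \<in> span {component x \<alpha>}"
        using csc x(2) G component_Gplus_mem_Lplus
        unfolding completely_self_centralizing_def self_centralizing_in_def by blast
      then obtain c where c: "component y \<beta> = scale c (component x \<alpha>)"
        by (auto simp: span_singleton)
      then have "component y \<beta> \<in> weight_space H \<alpha>"
        using component_mem subspace_scale[OF subspace_weight_space] by simp
      then have "component (component y \<beta>) \<beta> = (if \<beta> = \<alpha> then component y \<beta> else 0)"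
        using G Gplus_dual by (intro component_weight_vector) auto
      moreover have "component (component y \<beta>) \<beta> = component y \<beta>"
        using component_weight_vector[OF _ component_mem, of \<beta>] G Gplus_dual by auto
      ultimately have "\<beta> = \<alpha>"
        using \<beta>(1) by (auto split: if_splits)
      then show ?thesis using c \<beta>(1) by auto
    qed
    \<comment> \<open>Once the component at \<open>\<alpha>\<close> is cancelled, no positive component can survive: otherwise
      the component at \<open>\<alpha>\<close> would be nonzero.\<close>
    have "\<exists>c. \<forall>\<gamma>\<in>Gplus. component (y - scale c x) \<gamma> = 0" if y: "y \<in> s" for y
    proof (cases "\<exists>\<gamma>\<in>Gplus. component y \<gamma> \<noteq> 0")
      case True
      then obtain c where c: "component y \<alpha> = scale c (component x \<alpha>)" using top[OF y] by blast
      have "y - scale c x \<in> s" using y x(1) sub subspace_diff subspace_scale by metis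
      moreover have "component (y - scale c x) \<alpha> = 0"
        using c by (simp add: component_diff component_scale)
      ultimately show ?thesis using top by blast
    next
      case False
      then have "\<forall>\<gamma>\<in>Gplus. component (y - scale 0 x) \<gamma> = 0" by simp
      then show ?thesis by blast
    qed
    then show ?thesis using x(1) by blast
  qed
qed

section \<open>Dimension bound and graded subalgebras\<close>

lemma subalgebra_sigma:
  assumes "subalgebra s"
  shows "subalgebra (\<sigma> ` s)"
  unfolding subalgebra_def
proof
  have sub: "subspace s" and closed: "\<And>x y. x \<in> s \<Longrightarrow> y \<in> s \<Longrightarrow> bracket x y \<in> s"
    using assms unfolding subalgebra_def by auto
  show "subspace (\<sigma> ` s)"
  proof (rule subspaceI)
    show "0 \<in> \<sigma> ` s" using subspace_0[OF sub] by (metis image_eqI sigma_zero)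
  qed (auto simp flip: sigma_add sigma_scale intro: imageI subspace_add[OF sub] subspace_scale[OF sub])
  show "\<forall>x\<in>\<sigma> ` s. \<forall>y\<in>\<sigma> ` s. bracket x y \<in> \<sigma> ` s"
    using closed by (auto simp flip: sigma_bracket)
qed

lemma fin_dim_sigma:
  assumes "fin_dim s"
  shows "fin_dim (\<sigma> ` s)"
proof -
  obtain B where B: "finite B" "s = span B" using assms unfolding fin_dim_def by blast
  have "Vector_Spaces.linear scale scale \<sigma>" using anti_involution unfolding anti_involution_def by blast
  then interpret sigma: Vector_Spaces.linear scale scale \<sigma> .
  have "\<sigma> ` s = span (\<sigma> ` B)" using B(2) sigma.span_image by simp
  then show ?thesis using B(1) unfolding fin_dim_def by blast
qed

text \<open>\<open>?N\<close> and \<open>?P\<close> below consist of the vectors without positive, respectively negative,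
  components; their intersection is \<open>H\<close>. Each cuts \<open>s\<close> in codimension at most one: \<open>?N\<close> by the
  leading term argument for \<open>s\<close>, \<open>?P\<close> by the same for \<open>\<sigma> ` s\<close>.\<close>

lemma subalgebra_subset_span:
  assumes csc: "completely_self_centralizing Lplus" and s: "subalgebra s" "fin_dim s"
  shows "\<exists>x y. s \<subseteq> span (insert x (insert y (s \<inter> H)))"
proof -
  let ?N = "{v. \<forall>\<gamma>\<in>Gplus. component v \<gamma> = 0}"
  let ?P = "{v. \<forall>\<gamma>\<in>Gplus. component v (- \<gamma>) = 0}"
  have sub: "subspace s" using s(1) unfolding subalgebra_def by blast
  have N: "subspace ?N" and P: "subspace ?P"
    by (auto intro!: subspaceI simp: component_add component_scale)
  note sN = subspace_inter[OF sub N]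
  obtain x where x: "x \<in> s" "\<And>v. v \<in> s \<Longrightarrow> \<exists>c. v - scale c x \<in> ?N"
    using positive_part_corank_one[OF csc s] by auto
  obtain y' where y': "y' \<in> \<sigma> ` s" "\<And>v. v \<in> \<sigma> ` s \<Longrightarrow> \<exists>c. v - scale c y' \<in> ?N"
    using positive_part_corank_one[OF csc subalgebra_sigma[OF s(1)] fin_dim_sigma[OF s(2)]] by auto
  have y0: "\<exists>c. v - scale c (\<sigma> y') \<in> ?P" if v: "v \<in> s" for v
  proof -
    obtain c where c: "\<sigma> v - scale c y' \<in> ?N" using y'(2) v by blast
    have "v - scale c (\<sigma> y') = \<sigma> (\<sigma> v - scale c y')"
      by (simp add: sigma_diff sigma_scale)
    then have "v - scale c (\<sigma> y') \<in> ?P" using c by (simp add: component_sigma)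
    then show ?thesis by blast
  qed
  obtain y where y: "y \<in> s \<inter> ?N" "\<And>v. v \<in> s \<inter> ?N \<Longrightarrow> \<exists>c. v - scale c y \<in> ?P"
  proof (cases "s \<inter> ?N \<subseteq> ?P")
    case True
    then have "\<exists>c. v - scale c 0 \<in> ?P" if "v \<in> s \<inter> ?N" for v using that by auto
    then show ?thesis using that[of 0] subspace_0[OF sub] by auto
  next
    case False
    then obtain y where y: "y \<in> s \<inter> ?N" "y \<notin> ?P" by blast
    have "\<exists>c. v - scale c y \<in> ?P" if "v \<in> s \<inter> ?N" for v
      by (rule corank_one_exchange[OF P sN y0 y that]) auto
    then show ?thesis using that y(1) by blast
  qed
  have "v \<in> span (insert x (insert y (s \<inter> H)))" if v: "v \<in> s" for v
  proof -
    obtain c where c: "v - scale c x \<in> ?N" using x(2) v by blast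
    have w: "v - scale c x \<in> s \<inter> ?N"
      using c subspace_diff[OF sub v subspace_scale[OF sub x(1)]] by blast
    then obtain d where d: "v - scale c x - scale d y \<in> ?P" using y(2) by blast
    have "v - scale c x - scale d y \<in> s \<inter> ?N"
      by (rule subspace_diff[OF sN w subspace_scale[OF sN y(1)]])
    then have "v - scale c x - scale d y \<in> s \<inter> H"
      using d mem_H_if_components_zero by auto
    then have "v - scale c x - scale d y \<in> span (s \<inter> H)" by (rule span_base)
    then show ?thesis unfolding span_breakdown_eq by blast
  qed
  then show ?thesis by blast
qed

lemma component_mem_subalgebra:
  assumes s: "subalgebra s" "H \<subseteq> s" and v: "v \<in> s"
  shows "component v \<gamma> \<in> s"
proof (cases "component v \<gamma> = 0")
  case True
  then show ?thesis using s(1) subspace_0 unfolding subalgebra_def by simp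
next
  case False
  let ?J = "{\<gamma>. component v \<gamma> \<noteq> 0}"
  have "\<forall>\<alpha>\<in>?J. component v \<alpha> \<in> s"
  proof (rule weight_parts_mem_stable_subspace[where H = H])
    show "subspace s" "\<And>h w. h \<in> H \<Longrightarrow> w \<in> s \<Longrightarrow> bracket h w \<in> s"
      using s unfolding subalgebra_def by auto
    show "sum (component v) ?J \<in> s" using component_sum_eq v by simp
  qed (auto simp: finite_component_support component_mem component_mem_dual)
  then show ?thesis using False by simp
qed

text \<open>A nonzero element of \<open>s \<inter> Lplus\<close> has a nonzero component, which again lies in \<open>s \<inter> Lplus\<close>
  because \<open>s\<close> is graded. It spans \<open>s \<inter> Lplus\<close>, as elements of \<open>s\<close> agree up to a multiple of it
  and a vector without positive components. When \<open>s \<inter> Lplus = {0}\<close> the witness is \<open>0\<close>, and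
  \<open>Lplus \<noteq> {0}\<close> supplies some \<open>\<alpha>\<close>.\<close>

lemma positive_part_homogeneous:
  assumes csc: "completely_self_centralizing Lplus" and s: "subalgebra s" "fin_dim s" "H \<subseteq> s"
    and "Lplus \<noteq> {0}"
  shows "\<exists>\<alpha>\<in>Gplus. \<exists>x\<in>weight_space H \<alpha>. x \<in> s \<inter> Lplus \<and> s \<inter> Lplus \<subseteq> span {x}"
proof (cases "s \<inter> Lplus \<subseteq> {0}")
  case True
  obtain p where "p \<in> Lplus" "p \<noteq> 0" using \<open>Lplus \<noteq> {0}\<close> subspace_0[OF subspace_Lplus] by blast
  then obtain \<alpha> where "\<alpha> \<in> Gplus" using mem_Lplus_component_zero by blast
  moreover have "0 \<in> weight_space H \<alpha>" by (rule subspace_0[OF subspace_weight_space])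
  moreover have "0 \<in> s" using s(1) subspace_0 unfolding subalgebra_def by blast
  ultimately show ?thesis
    using True subspace_0[OF subspace_Lplus] by (intro bexI[of _ \<alpha>] bexI[of _ 0]) auto
next
  case False
  have sub: "subspace s" using s(1) unfolding subalgebra_def by blast
  let ?N = "{v. \<forall>\<gamma>\<in>Gplus. component v \<gamma> = 0}"
  have N: "subspace ?N" by (auto intro!: subspaceI simp: component_add component_scale)
  obtain p where p: "p \<in> s" "p \<in> Lplus" "p \<noteq> 0" using False by blast
  then obtain \<alpha> where \<alpha>: "\<alpha> \<in> Gplus" "component p \<alpha> \<noteq> 0" using mem_Lplus_component_zero by blast
  let ?x = "component p \<alpha>"
  have x: "?x \<in> s" "?x \<in> Lplus" "?x \<in> weight_space H \<alpha>"
    using component_mem_subalgebra[OF s(1,3) p(1)] component_Lplus(1)[OF p(2)] component_mem by auto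
  have "?x \<notin> ?N" using mem_Lplus_component_zero[OF x(2)] \<alpha>(2) by blast
  obtain x0 where x0: "\<And>v. v \<in> s \<Longrightarrow> \<exists>c. v - scale c x0 \<in> ?N"
    using positive_part_corank_one[OF csc s(1,2)] by auto
  have "u \<in> span {?x}" if u: "u \<in> s \<inter> Lplus" for u
  proof -
    obtain c where c: "u - scale c ?x \<in> ?N"
      using corank_one_exchange[OF N sub x0 x(1) \<open>?x \<notin> ?N\<close>, of u] u by blast
    moreover have "u - scale c ?x \<in> Lplus"
      using u x(2) subspace_Lplus subspace_diff subspace_scale by (metis IntD2)
    ultimately have "u - scale c ?x = 0" using mem_Lplus_component_zero by blast
    then show ?thesis by (auto simp: span_singleton)
  qed
  then show ?thesis using \<alpha>(1) x by blast
qed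

lemma subalgebra_triangular:
  assumes s: "subalgebra s" "H \<subseteq> s" and v: "m \<in> Lminus" "h \<in> H" "p \<in> Lplus" "m + h + p \<in> s"
  shows "m \<in> s \<and> p \<in> s"
proof -
  have sub: "subspace s" using s(1) unfolding subalgebra_def by blast
  have "component p \<gamma> \<in> s" for \<gamma>
    using component_triangular(1)[OF v(1-3)] component_mem_subalgebra[OF s v(4)]
      component_Lplus(2)[OF v(3)] subspace_0[OF sub] by metis
  then have "p \<in> s" using component_sum_eq[of p] subspace_sum[OF sub] by metis
  moreover have "m = m + h + p - h - p" by simp
  then have "m \<in> s" using v(2,4) s(2) \<open>p \<in> s\<close> subspace_diff[OF sub] by (metis subsetD)
  ultimately show ?thesis by blast
qed

text \<open>The negative half is the positive half of \<open>\<sigma> ` s\<close>, carried back by \<open>\<sigma>\<close>.\<close>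

lemma subalgebra_containing_H:
  assumes csc: "completely_self_centralizing Lplus" and s: "subalgebra s" "fin_dim s" "H \<subseteq> s"
    and "Lplus \<noteq> {0}"
  shows "\<exists>\<alpha>\<in>Gplus. \<exists>\<beta>\<in>Gplus. \<exists>x\<in>weight_space H \<alpha>. \<exists>y\<in>weight_space H (- \<beta>).
    direct_sum_list [span {y}, H, span {x}] s"
proof -
  have sub: "subspace s" using s(1) unfolding subalgebra_def by blast
  obtain \<alpha> x where x: "\<alpha> \<in> Gplus" "x \<in> weight_space H \<alpha>" "x \<in> s" "x \<in> Lplus"
      "s \<inter> Lplus \<subseteq> span {x}"
    using positive_part_homogeneous[OF csc s \<open>Lplus \<noteq> {0}\<close>] by blast
  have "H \<subseteq> \<sigma> ` s" using s(3) sigma_H by force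
  then obtain \<beta> y' where y': "\<beta> \<in> Gplus" "y' \<in> weight_space H \<beta>" "y' \<in> \<sigma> ` s" "y' \<in> Lplus"
      "\<sigma> ` s \<inter> Lplus \<subseteq> span {y'}"
    using positive_part_homogeneous[OF csc subalgebra_sigma[OF s(1)] fin_dim_sigma[OF s(2)] _
        \<open>Lplus \<noteq> {0}\<close>] by blast
  let ?y = "\<sigma> y'"
  have y: "?y \<in> weight_space H (- \<beta>)" "?y \<in> s" "?y \<in> Lminus"
    using sigma_weight_space[OF y'(2)] y'(3,4) sigma_Lplus by auto
  have minus: "m \<in> span {?y}" if m: "m \<in> s" "m \<in> Lminus" for m
  proof -
    have "\<sigma> m \<in> \<sigma> ` s \<inter> Lplus" using m sigma_Lplus by auto
    then obtain c where "\<sigma> m = scale c y'" using y'(5) by (auto simp: span_singleton)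
    then have "m = scale c ?y" by (metis sigma_scale sigma_sigma)
    then show ?thesis by (auto simp: span_singleton)
  qed
  have "s \<subseteq> span (span {?y} \<union> H \<union> span {x})"
  proof
    fix v assume "v \<in> s"
    obtain m h p where v: "m \<in> Lminus" "h \<in> H" "p \<in> Lplus" "v = m + h + p"
      by (rule triangular_decomposition)
    have "m \<in> s" "p \<in> s" using subalgebra_triangular[OF s(1,3) v(1-3)] v(4) \<open>v \<in> s\<close> by auto
    then have "m \<in> span {?y}" "p \<in> span {x}" using minus v(1,3) x(5) by auto
    then show "v \<in> span (span {?y} \<union> H \<union> span {x})"
      unfolding v(4) using v(2) by (intro span_add span_base) auto
  qed
  moreover have "span {?y} \<subseteq> s" "span {x} \<subseteq> s"
    using x(3) y(2) sub by (simp_all add: span_minimal)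
  then have "span (span {?y} \<union> H \<union> span {x}) \<subseteq> s"
    using s(3) sub by (intro span_minimal) auto
  ultimately have "s = span (span {?y} \<union> H \<union> span {x})" by blast
  moreover have "direct_sum_list [span {?y}, H, span {x}] (span (span {?y} \<union> H \<union> span {x}))"
    by (rule direct_sum_list_three_subspaces[OF direct_sum_UNIV])
      (use x(4) y(3) subspace_H subspace_Lplus subspace_Lminus in \<open>simp_all add: span_minimal\<close>)
  ultimately show ?thesis using x(1,2) y'(1) y(1) by metis
qed

end

theorem proposition5p1:
  fixes scale :: "'f::field \<Rightarrow> 'v::ab_group_add \<Rightarrow> 'v"
    and bracket :: "'v \<Rightarrow> 'v \<Rightarrow> 'v"
    and Lminus H Lplus :: "'v set"
    and Gplus :: "('v \<Rightarrow> 'f) set"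
    and k :: nat
    and s :: "'v set"
  assumes "lie_algebra scale bracket"
    and "lie_algebra.regular_weakly_triangular_decomposition scale bracket Lminus H Lplus Gplus"
    and "lie_algebra.completely_self_centralizing scale bracket Lplus"
    and "vector_space.dim scale H = k"
    and "lie_algebra.subalgebra scale bracket s"
    and "lie_algebra.fin_dim scale s"
  shows "vector_space.dim scale s \<le> k + 2 \<and>
    (vector_space.dim scale s = k + 2 \<longrightarrow>
      (\<exists>\<alpha>\<in>Gplus. \<exists>\<beta>\<in>Gplus.
        \<exists>x\<in>lie_algebra.weight_space scale bracket H \<alpha>.
        \<exists>y\<in>lie_algebra.weight_space scale bracket H (- \<beta>).
          lie_algebra.direct_sum_list scale
            [module.span scale {y}, H, module.span scale {x}] s))"
proof -
  interpret lie_algebra scale bracket by fact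
  have wtd: "weakly_triangular_decomposition Lminus H Lplus Gplus"
    and fin: "\<forall>\<alpha>\<in>dual H. fin_dim (weight_space H \<alpha>)"
    using assms(2) unfolding regular_weakly_triangular_decomposition_def by auto
  obtain \<sigma> where \<sigma>: "anti_involution \<sigma>" "\<sigma> ` Lplus = Lminus" "\<forall>h\<in>H. \<sigma> h = h"
    using wtd unfolding weakly_triangular_decomposition_def by blast
  obtain r where r: "linear_order_on Gplus r"
      "\<forall>\<alpha>\<in>Gplus. \<forall>\<beta>\<in>Gplus. (\<alpha>, \<alpha> + \<beta>) \<in> r \<and> \<alpha> + \<beta> \<noteq> \<alpha>"
      "\<forall>\<alpha>\<in>Gplus. \<forall>\<beta>\<in>Gplus. \<forall>\<gamma>\<in>Gplus. (\<gamma>, \<beta>) \<in> r \<longrightarrow> (\<alpha> + \<gamma>, \<alpha> + \<beta>) \<in> r"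
    using wtd unfolding weakly_triangular_decomposition_def by blast
  have nz: "Lplus \<noteq> {0}"
    using wtd unfolding weakly_triangular_decomposition_def by blast
  have "free_additive_semigroup Gplus"
    using wtd unfolding weakly_triangular_decomposition_def by blast
  note Gplus_add = free_additive_semigroup_add[OF this]
  have "subspace Lminus" "subspace H" "subspace Lplus" "direct_sum_list [Lminus, H, Lplus] UNIV"
    "\<forall>x\<in>H. \<forall>y\<in>H. bracket x y = 0" "Gplus \<subseteq> dual H"
    and Lplus: "direct_sum (Gplus - {0}) (\<lambda>\<alpha>. Lplus \<inter> weight_space H \<alpha>) Lplus"
    using wtd unfolding weakly_triangular_decomposition_def subalgebra_def
    by - (elim conjE, assumption)+
  moreover have "Lplus = span (\<Union>\<alpha>\<in>Gplus - {0}. Lplus \<inter> weight_space H \<alpha>)"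
    using Lplus unfolding direct_sum_def by (elim conjE)
  ultimately interpret weakly_triangular_algebra scale bracket Lminus H Lplus Gplus \<sigma> r
    using \<sigma> r Gplus_add by unfold_locales blast+
  have "fin_dim H" using fin zero_mem_dual weight_space_zero_eq_H by metis
  moreover obtain x y where "s \<subseteq> span (insert x (insert y (s \<inter> H)))"
    using subalgebra_subset_span[OF assms(3,5,6)] by blast
  moreover have "subspace s" using assms(5) unfolding subalgebra_def by blast
  ultimately have "dim s \<le> k + 2" "dim s = k + 2 \<Longrightarrow> H \<subseteq> s"
    using dim_span_insert_two assms(4) by auto
  then show ?thesis
    using subalgebra_containing_H[OF assms(3,5,6) _ nz] by blast
qed

end
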